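(* Let $1\le p<\infty$ and let $A, B \in \mathbb{C}^{n\times n}$ be Hermitian positive semi-definite. If $\operatorname{rank}(B)=1$, then $$1 \le \sqrt[p]{\operatorname{sr}_p(A+B)} \le 1 + \sqrt[p]{\operatorname{sr}_p(A)}.$$
   Context: For $1\le p<\infty$ and $A\in\mathbb{C}^{m\times n}$ with singular values $\sigma_1(A)\ge\cdots\ge\sigma_{\min\{m,n\}}(A)\ge 0$, the Schatten $p$-norm is $\|A\|_{(p)} = \left(\sum_{j}\sigma_j(A)^p\right)^{1/p}$, and $\|A\|_2=\sigma_1(A)$ is the operator two-norm. The $p$-stable rank of a non-zero matrix $A$ is $\operatorname{sr}_p(A) = \|A\|_{(p)}^p/\|A\|_2^p$; for the zero matrix, $\operatorname{sr}_p(0)=0$. *)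

theory Defs
  imports
    "HOL-Computational_Algebra.Fundamental_Theorem_Algebra"
    "Jordan_Normal_Form.Schur_Decomposition"
    "Jordan_Normal_Form.DL_Rank"
begin

definition hermitian_mat :: "complex mat \<Rightarrow> bool" where
  "hermitian_mat A \<longleftrightarrow> mat_adjoint A = A"

(* The product \<bullet>c conjugates its second argument, so (A *\<^sub>v v) \<bullet>c v is v^* A v. *)
definition hermitian_psd :: "complex mat \<Rightarrow> bool" where
  "hermitian_psd A \<longleftrightarrow> hermitian_mat A \<and>
     (\<forall>v \<in> carrier_vec (dim_row A). 0 \<le> Re ((A *\<^sub>v v) \<bullet>c v))"

(* Singular values in decreasing order, with multiplicity: the square roots of the eigenvalues
   (real and nonnegative, whence Re) of A^* A.  That matrix has dim_col A eigenvalues; if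
   dim_row A < dim_col A, the surplus ones are zero and are cut off at the end of the list. *)
definition singular_values :: "complex mat \<Rightarrow> real list" where
  "singular_values A =
     take (min (dim_row A) (dim_col A))
       (rev (sorted_list_of_multiset
         (image_mset (\<lambda>z. sqrt (Re z)) (proots (char_poly (mat_adjoint A * A))))))"

lemma length_singular_values: "length (singular_values A) = min (dim_row A) (dim_col A)"
proof -
  have "mat_adjoint A * A \<in> carrier_mat (dim_col A) (dim_col A)"
    by (intro carrier_matI) (simp_all add: mat_adjoint_def)
  hence "size (proots (char_poly (mat_adjoint A * A))) = dim_col A"
    using degree_monic_char_poly by (auto simp: size_proots_complex)
  hence "length (sorted_list_of_multiset
      (image_mset (\<lambda>z. sqrt (Re z)) (proots (char_poly (mat_adjoint A * A))))) = dim_col A"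
    by (metis mset_sorted_list_of_multiset size_image_mset size_mset)
  thus ?thesis
    by (simp add: singular_values_def)
qed

definition schatten_norm :: "real \<Rightarrow> complex mat \<Rightarrow> real" where
  "schatten_norm p A = (\<Sum>\<sigma>\<leftarrow>singular_values A. \<sigma> powr p) powr (1 / p)"

(* The largest singular value; 0 for a matrix without rows or without columns. *)
definition two_norm :: "complex mat \<Rightarrow> real" where
  "two_norm A = (if singular_values A = [] then 0 else singular_values A ! 0)"

definition stable_rank :: "real \<Rightarrow> complex mat \<Rightarrow> real" where
  "stable_rank p A =
     (if A = 0\<^sub>m (dim_row A) (dim_col A) then 0
      else schatten_norm p A powr p / two_norm A powr p)"

end

theory Submission
  imports Defs "Jordan_Normal_Form.Spectral_Radius" "HOL-Analysis.Convex"
begin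

text \<open>
  In an orthonormal eigenbasis of $A + B$, the eigenvalues of $A + B$ are sums of diagonal entries
  of $A$ and of $B$. The diagonal of a Hermitian matrix in any orthonormal basis is a doubly
  stochastic image of its spectrum, so by Jensen its $p$-th power sum is at most that of the
  eigenvalues, and Minkowski's inequality for vectors gives the triangle inequality for the
  Schatten norm of positive semi-definite matrices. For $B$ of rank one, the Schatten norm is the
  two-norm; as the two-norms of $A$ and $B$ are both at most that of $A + B$, dividing by the latter
  gives the upper bound.
\<close>

(* The notation clashes with the scalar product of Jordan_Normal_Form. *)
no_notation inner (infix "\<bullet>" 70)

subsection \<open>Unitary diagonalization\<close>

lemma dim_mat_adjoint [simp]:
  "dim_row (mat_adjoint A) = dim_col A" "dim_col (mat_adjoint A) = dim_row A"
  by (simp_all add: mat_adjoint_def)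

lemma mat_adjoint_carrier [simp]:
  "A \<in> carrier_mat m n \<Longrightarrow> mat_adjoint A \<in> carrier_mat n m"
  by (auto intro: carrier_matI)

lemma index_mat_adjoint [simp]:
  fixes A :: "complex mat"
  assumes "i < dim_col A" "j < dim_row A"
  shows "mat_adjoint A $$ (i, j) = cnj (A $$ (j, i))"
  using assms by (simp add: mat_adjoint_def mat_of_rows_def)

lemma mat_adjoint_mat_adjoint [simp]:
  fixes A :: "complex mat"
  shows "mat_adjoint (mat_adjoint A) = A"
  by (rule eq_matI) auto

lemma mat_adjoint_mult:
  fixes A B :: "complex mat"
  assumes "A \<in> carrier_mat m k" "B \<in> carrier_mat k n"
  shows "mat_adjoint (A * B) = mat_adjoint B * mat_adjoint A"
  using assms by (intro eq_matI) (auto simp: scalar_prod_def mult.commute intro!: sum.cong)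

text \<open>The other equation comes for free: a left inverse of a square matrix is also a right
  inverse.\<close>

definition unitary_mat :: "nat \<Rightarrow> complex mat \<Rightarrow> bool" where
  "unitary_mat n U \<longleftrightarrow> U \<in> carrier_mat n n \<and> mat_adjoint U * U = 1\<^sub>m n"

lemma unitary_matD:
  assumes "unitary_mat n U"
  shows "U \<in> carrier_mat n n" "mat_adjoint U * U = 1\<^sub>m n" "U * mat_adjoint U = 1\<^sub>m n"
proof -
  show U: "U \<in> carrier_mat n n" and UU: "mat_adjoint U * U = 1\<^sub>m n"
    using assms by (auto simp: unitary_mat_def)
  show "U * mat_adjoint U = 1\<^sub>m n"
    using mat_mult_left_right_inverse[OF mat_adjoint_carrier[OF U] U UU] .
qed

lemma unitary_mat_adjoint:
  assumes "unitary_mat n U"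
  shows "unitary_mat n (mat_adjoint U)"
  using unitary_matD[OF assms] by (auto simp: unitary_mat_def)

lemma unitary_mat_mult:
  assumes "unitary_mat n U" "unitary_mat n V"
  shows "unitary_mat n (U * V)"
proof -
  note U = unitary_matD[OF assms(1)] and V = unitary_matD[OF assms(2)]
  have "mat_adjoint (U * V) * (U * V) = mat_adjoint V * mat_adjoint U * (U * V)"
    using U(1) V(1) by (simp add: mat_adjoint_mult)
  also have "\<dots> = mat_adjoint V * (mat_adjoint U * U * V)"
    using U(1) V(1) by (simp add: assoc_mult_mat[where n\<^sub>2=n and n\<^sub>3=n and n\<^sub>4=n and n\<^sub>1=n])
  also have "\<dots> = 1\<^sub>m n"
    using U V by simp
  finally show ?thesis
    using U(1) V(1) by (simp add: unitary_mat_def)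
qed

section \<open>Orthonormal bases and the spectral theorem\<close>

lemma cscalar_prod_self_pos:
  fixes v :: "complex vec"
  assumes "v \<bullet>c v \<noteq> 0"
  shows "v \<bullet>c v = of_real (Re (v \<bullet>c v))" "Re (v \<bullet>c v) > 0"
proof -
  have "v \<bullet>c v \<ge> 0" by (rule conjugate_square_ge_0_vec)
  thus "v \<bullet>c v = of_real (Re (v \<bullet>c v))" "Re (v \<bullet>c v) > 0"
    using assms by (auto simp: less_eq_complex_def complex_eq_iff)
qed

text \<open>Complete \<open>v\<close> to a basis, orthogonalize by Gram-Schmidt, which keeps the
  first vector, and normalize. With \<open>v\<close> an eigenvector, this \<open>U\<close> splits
  off one dimension in the spectral theorem.\<close>

lemma ex_unitary_mat_col_0:
  fixes v :: "complex vec"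
  assumes v: "v \<in> carrier_vec n" and v0: "v \<noteq> 0\<^sub>v n"
  shows "\<exists>U c. unitary_mat n U \<and> col U 0 = c \<cdot>\<^sub>v v"
proof -
  interpret cof_vec_space n "TYPE(complex)" .
  define b where "b = basis_completion v"
  define ws where "ws = gram_schmidt n b"
  have n: "n > 0" using v v0 by (cases n) auto
  note b = basis_completion[OF v v0, folded b_def]
  have ws: "set ws \<subseteq> carrier_vec n" "corthogonal ws" "length ws = n"
    using gram_schmidt_result[OF b(2,4,5) ws_def] b(6) by auto
  obtain vs where "b = v # vs" using b(6,7) n by (cases b) auto
  hence "hd ws = v" using gram_schmidt_hd[OF v] by (simp add: ws_def)
  hence ws0: "ws ! 0 = v" using ws(3) n by (metis hd_conv_nth length_0_conv less_numeral_extra(3))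
  have wsc: "ws ! i \<in> carrier_vec n" if "i < n" for i
    using ws that by auto
  have wsn: "ws ! j \<bullet>c ws ! i = 0 \<longleftrightarrow> i \<noteq> j" if "i < n" "j < n" for i j
    using corthogonalD[OF ws(2), of j i] that ws(3) by auto
  \<comment> \<open>\<open>gram_schmidt\<close> orthogonalizes without normalizing;
    \<open>r i\<close> is the Euclidean length by which column \<open>i\<close> is divided.\<close>
  define r where "r i = sqrt (Re (ws ! i \<bullet>c ws ! i))" for i
  have r: "r i > 0" "ws ! i \<bullet>c ws ! i = of_real (r i) * of_real (r i)" if "i < n" for i
    using cscalar_prod_self_pos[of "ws ! i"] wsn[of i i] that
    by (auto simp: r_def simp flip: of_real_mult)
  define U where "U = mat n n (\<lambda>(i, j). ws ! j $ i / of_real (r j))"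
  have "mat_adjoint U * U = 1\<^sub>m n"
  proof (rule eq_matI)
    fix i j assume ij: "i < dim_row (1\<^sub>m n)" "j < dim_col (1\<^sub>m n)"
    have "(mat_adjoint U * U) $$ (i, j)
        = (\<Sum>k<n. cnj (ws ! i $ k / of_real (r i)) * (ws ! j $ k / of_real (r j)))"
      using ij by (auto simp: U_def scalar_prod_def lessThan_atLeast0 intro!: sum.cong)
    also have "\<dots> = (ws ! j \<bullet>c ws ! i) / (of_real (r i) * of_real (r j))"
      using ij wsc[of i] wsc[of j]
      by (simp add: scalar_prod_def lessThan_atLeast0 sum_divide_distrib mult.commute)
    also have "\<dots> = 1\<^sub>m n $$ (i, j)"
      using ij wsn[of i j] r[of i] by auto
    finally show "(mat_adjoint U * U) $$ (i, j) = 1\<^sub>m n $$ (i, j)" .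
  qed (auto simp: U_def)
  moreover have "col U 0 = (1 / of_real (r 0)) \<cdot>\<^sub>v v"
    using n v by (intro eq_vecI) (auto simp: U_def ws0)
  moreover have "U \<in> carrier_mat n n" by (simp add: U_def)
  ultimately show ?thesis
    unfolding unitary_mat_def by blast
qed

text \<open>Real diagonal entries suit Hermitian spectra and keep all later power sums in the
  reals.\<close>

definition real_diag :: "nat \<Rightarrow> (nat \<Rightarrow> real) \<Rightarrow> complex mat" where
  "real_diag n d = mat n n (\<lambda>(i, j). if i = j then of_real (d i) else 0)"

lemma real_diag_carrier [simp]: "real_diag n d \<in> carrier_mat n n"
  by (simp add: real_diag_def)

lemma unitary_conj_mult:
  fixes U V A :: "complex mat"
  assumes "U \<in> carrier_mat n n" "V \<in> carrier_mat n n" "A \<in> carrier_mat n n"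
  shows "mat_adjoint (U * V) * A * (U * V) = mat_adjoint V * (mat_adjoint U * A * U) * V"
  unfolding mat_adjoint_mult[OF assms(1,2)] using assms
  by (simp add: mult_carrier_mat[where n=n] assoc_mult_mat[where n\<^sub>2=n and n\<^sub>3=n and n\<^sub>4=n and n\<^sub>1=n])

lemma mat_adjoint_block_diag:
  fixes A D :: "complex mat"
  assumes "A \<in> carrier_mat k k" "D \<in> carrier_mat m m"
  shows "mat_adjoint (four_block_mat A (0\<^sub>m k m) (0\<^sub>m m k) D)
    = four_block_mat (mat_adjoint A) (0\<^sub>m k m) (0\<^sub>m m k) (mat_adjoint D)"
  using assms by (intro eq_matI) auto

lemma mult_block_diag:
  fixes A D A' D' :: "complex mat"
  assumes "A \<in> carrier_mat k k" "D \<in> carrier_mat m m" "A' \<in> carrier_mat k k" "D' \<in> carrier_mat m m"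
  shows "four_block_mat A (0\<^sub>m k m) (0\<^sub>m m k) D * four_block_mat A' (0\<^sub>m k m) (0\<^sub>m m k) D'
    = four_block_mat (A * A') (0\<^sub>m k m) (0\<^sub>m m k) (D * D')"
  using assms by (subst mult_four_block_mat) auto

text \<open>Deflation: in an orthonormal basis whose first vector is an eigenvector, the first
  column vanishes below the diagonal, and by symmetry so does the first row. The remaining block is
  Hermitian of size \<open>m\<close>, and induction applies to it.\<close>

theorem hermitian_spectral:
  assumes "A \<in> carrier_mat n n" "hermitian_mat A"
  shows "\<exists>U d. unitary_mat n U \<and> mat_adjoint U * A * U = real_diag n d"
  using assms
proof (induction n arbitrary: A)
  case 0
  show ?case
    by (intro exI[of _ "1\<^sub>m 0"] exI[of _ "\<lambda>_. 0"] conjI eq_matI) (auto simp: unitary_mat_def real_diag_def)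
next
  case (Suc m)
  let ?n = "Suc m"
  note A = Suc.prems(1)
  have hA: "mat_adjoint A = A" using Suc.prems(2) by (simp add: hermitian_mat_def)
  obtain e where "eigenvalue A e"
    using spectrum_non_empty[OF A] by (auto simp: spectrum_def)
  then obtain v where v: "v \<in> carrier_vec ?n" "v \<noteq> 0\<^sub>v ?n" "A *\<^sub>v v = e \<cdot>\<^sub>v v"
    using A by (auto simp: eigenvalue_def eigenvector_def)
  obtain W c where W: "unitary_mat ?n W" and Wv: "col W 0 = c \<cdot>\<^sub>v v"
    using ex_unitary_mat_col_0[OF v(1,2)] by blast
  note Wc = unitary_matD[OF W]
  define A' where "A' = mat_adjoint W * A * W"
  have A': "A' \<in> carrier_mat ?n ?n" using A Wc(1) by (simp add: A'_def mult_carrier_mat[where n="?n"])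
  have hA': "mat_adjoint A' = A'"
    using A Wc(1) hA
    by (simp add: A'_def mat_adjoint_mult[where k="?n" and m="?n" and n="?n"]
        assoc_mult_mat[where n\<^sub>2="?n" and n\<^sub>3="?n" and n\<^sub>4="?n" and n\<^sub>1="?n"])
  \<comment> \<open>The first column of \<open>W\<close> is a multiple of \<open>v\<close>, hence
    satisfies the eigenvector equation. Pairing it with the orthonormal columns of \<open>W\<close>
    gives column 0 of \<open>A'\<close>.\<close>
  have "col (A * W) 0 = A *\<^sub>v col W 0"
    using A Wc(1) by (intro col_mult2) auto
  also have "\<dots> = e \<cdot>\<^sub>v col W 0"
    using A v by (simp add: Wv mult_mat_vec smult_smult_assoc mult.commute)
  finally have AW0: "col (A * W) 0 = e \<cdot>\<^sub>v col W 0" .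
  have A'i0: "A' $$ (i, 0) = (if i = 0 then e else 0)" if i: "i < ?n" for i
  proof -
    have "A' $$ (i, 0) = (mat_adjoint W * (A * W)) $$ (i, 0)"
      using A Wc(1) by (simp add: A'_def assoc_mult_mat[where n\<^sub>2="?n" and n\<^sub>3="?n" and n\<^sub>4="?n" and n\<^sub>1="?n"])
    also have "\<dots> = row (mat_adjoint W) i \<bullet> col (A * W) 0"
      using A Wc(1) i by (intro index_mult_mat) auto
    also have "\<dots> = e * (row (mat_adjoint W) i \<bullet> col W 0)"
      unfolding AW0 using Wc(1) i by (intro scalar_prod_smult_right) auto
    also have "row (mat_adjoint W) i \<bullet> col W 0 = (mat_adjoint W * W) $$ (i, 0)"
      using Wc(1) i by (intro index_mult_mat[symmetric]) auto
    also have "\<dots> = (if i = 0 then 1 else 0)"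
      using Wc(2) i by simp
    finally show ?thesis by simp
  qed
  have A'ij: "A' $$ (i, j) = cnj (A' $$ (j, i))" if "i < ?n" "j < ?n" for i j
    using index_mat_adjoint[of i A' j] that A' hA' by auto
  \<comment> \<open>\<open>e\<close> is a diagonal entry of the Hermitian matrix \<open>A'\<close>,
    so it equals its own conjugate.\<close>
  have e: "e = of_real (Re e)"
    using A'ij[of 0 0] A'i0[of 0] by (simp add: complex_eq_iff)
  have A'0j: "A' $$ (0, j) = (if j = 0 then e else 0)" if "j < ?n" for j
    using A'ij[of 0 j] A'i0[OF that] A'i0[of 0] A'ij[of 0 0] that by (auto split: if_splits)
  define A3 where "A3 = mat m m (\<lambda>(i, j). A' $$ (Suc i, Suc j))"
  have A3: "A3 \<in> carrier_mat m m" by (simp add: A3_def)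
  have "hermitian_mat A3"
    unfolding hermitian_mat_def by (rule eq_matI) (auto simp: A3_def A'ij[symmetric])
  then obtain V d where V: "unitary_mat m V" and Vd: "mat_adjoint V * A3 * V = real_diag m d"
    using Suc.IH[OF A3] by blast
  note Vc = unitary_matD[OF V]
  define E :: "complex mat" where "E = mat 1 1 (\<lambda>_. e)"
  \<comment> \<open>\<open>F\<close> acts as \<open>V\<close> on the small block and fixes the
    eigenvector already found, so that conjugation by it leaves the entry \<open>e\<close>
    alone.\<close>
  define F where "F = four_block_mat (1\<^sub>m 1) (0\<^sub>m 1 m) (0\<^sub>m m 1) V"
  have E: "E \<in> carrier_mat 1 1" by (simp add: E_def)
  have A'block: "A' = four_block_mat E (0\<^sub>m 1 m) (0\<^sub>m m 1) A3"
    using A' A'i0 A'0j by (intro eq_matI) (auto simp: E_def A3_def)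
  have adj1: "mat_adjoint (1\<^sub>m 1 :: complex mat) = 1\<^sub>m 1" by (rule eq_matI) auto
  have F: "F \<in> carrier_mat ?n ?n" using Vc(1) by (auto simp: F_def)
  have adjF: "mat_adjoint F = four_block_mat (1\<^sub>m 1) (0\<^sub>m 1 m) (0\<^sub>m m 1) (mat_adjoint V)"
    unfolding F_def by (subst mat_adjoint_block_diag) (use Vc(1) adj1 in auto)
  have "mat_adjoint F * F = 1\<^sub>m ?n"
    unfolding adjF unfolding F_def
    by (subst mult_block_diag) (use Vc in auto)
  hence "unitary_mat ?n F" using F by (simp add: unitary_mat_def)
  hence "unitary_mat ?n (W * F)" using W unitary_mat_mult by blast
  moreover have "mat_adjoint (W * F) * A * (W * F)
      = real_diag ?n (\<lambda>i. case i of 0 \<Rightarrow> Re e | Suc j \<Rightarrow> d j)"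
  proof -
    have "mat_adjoint (W * F) * A * (W * F) = mat_adjoint F * A' * F"
      unfolding A'_def using unitary_conj_mult[OF Wc(1) F A] .
    also have "\<dots> = four_block_mat E (0\<^sub>m 1 m) (0\<^sub>m m 1) (mat_adjoint V * A3 * V)"
      unfolding adjF A'block unfolding F_def
      using E A3 Vc(1)
      by (simp add: mult_block_diag[where k=1 and m=m] mult_carrier_mat[where n=m] del: One_nat_def)
    also have "\<dots> = real_diag ?n (\<lambda>i. case i of 0 \<Rightarrow> Re e | Suc j \<Rightarrow> d j)"
      unfolding Vd using e by (intro eq_matI) (auto simp: real_diag_def E_def split: nat.split)
    finally show ?thesis .
  qed
  ultimately show ?case by blast
qed

subsection \<open>Diagonals and singular values in terms of the eigenvalues\<close>

lemma unitary_conj_cancel: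
  assumes "unitary_mat n U" "A \<in> carrier_mat n n" "mat_adjoint U * A * U = real_diag n d"
  shows "A = U * real_diag n d * mat_adjoint U"
proof -
  note U = unitary_matD[OF assms(1)]
  have "U * real_diag n d * mat_adjoint U = (U * mat_adjoint U) * A * (U * mat_adjoint U)"
    unfolding assms(3)[symmetric] using U(1) assms(2)
    by (simp add: mult_carrier_mat[where n=n] assoc_mult_mat[where n\<^sub>2=n and n\<^sub>3=n and n\<^sub>4=n and n\<^sub>1=n])
  thus ?thesis using U assms(2) by simp
qed

lemma real_diag_mult: "real_diag n d * real_diag n d' = real_diag n (\<lambda>i. d i * d' i)"
  by (rule eq_matI)
     (auto simp: real_diag_def scalar_prod_def if_distrib[of "\<lambda>x. x * _"] if_distrib[of "\<lambda>x. _ * x"]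
       cong: if_cong)

text \<open>For unitary \<open>Q\<close> the weights sum to 1 in each column, which turns the
  diagonal entries into averages of the \<open>d i\<close>.\<close>

lemma real_diag_conj_diag:
  assumes "Q \<in> carrier_mat n n" "j < n"
  shows "(mat_adjoint Q * real_diag n d * Q) $$ (j, j) = of_real (\<Sum>i<n. (cmod (Q $$ (i, j)))\<^sup>2 * d i)"
proof -
  have 1: "(mat_adjoint Q * real_diag n d) $$ (j, i) = cnj (Q $$ (i, j)) * of_real (d i)" if "i < n" for i
    using assms that
    by (auto simp: real_diag_def scalar_prod_def if_distrib[of "\<lambda>x. _ * x"] cong: if_cong)
  have "(mat_adjoint Q * real_diag n d * Q) $$ (j, j)
      = row (mat_adjoint Q * real_diag n d) j \<bullet> col Q j"
    using assms by (intro index_mult_mat) (auto simp: real_diag_def)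
  also have "\<dots> = (\<Sum>i<n. (mat_adjoint Q * real_diag n d) $$ (j, i) * Q $$ (i, j))"
    using assms by (auto simp: scalar_prod_def lessThan_atLeast0 real_diag_def intro!: sum.cong)
  also have "\<dots> = (\<Sum>i<n. of_real ((cmod (Q $$ (i, j)))\<^sup>2 * d i))"
    by (intro sum.cong refl) (simp add: 1 complex_norm_square mult_ac del: of_real_power)
  finally show ?thesis by simp
qed

lemma unitary_mat_col_sum:
  assumes "unitary_mat n Q" "j < n"
  shows "(\<Sum>i<n. (cmod (Q $$ (i, j)))\<^sup>2) = 1"
proof -
  note Q = unitary_matD[OF assms(1)]
  \<comment> \<open>The identity is invariant under unitary conjugation, so constant entries 1 in
    \<open>real_diag_conj_diag\<close> yield the sum of the weights.\<close>
  have "real_diag n (\<lambda>_. 1) = 1\<^sub>m n" by (rule eq_matI) (auto simp: real_diag_def)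
  hence "(mat_adjoint Q * real_diag n (\<lambda>_. 1) * Q) $$ (j, j) = 1"
    using Q assms(2) by simp
  hence "complex_of_real (\<Sum>i<n. (cmod (Q $$ (i, j)))\<^sup>2) = 1"
    using real_diag_conj_diag[OF Q(1) assms(2), of "\<lambda>_. 1"] by simp
  thus ?thesis by (simp only: of_real_eq_1_iff)
qed

lemma unitary_mat_row_sum:
  assumes "unitary_mat n Q" "i < n"
  shows "(\<Sum>j<n. (cmod (Q $$ (i, j)))\<^sup>2) = 1"
  using unitary_mat_col_sum[OF unitary_mat_adjoint[OF assms(1)] assms(2)] unitary_matD(1)[OF assms(1)] assms(2)
  by simp

text \<open>In the applications \<open>i\<close> numbers eigenvalues and \<open>j\<close> diagonal
  positions. Column sums make each diagonal entry an average, as Jensen requires; row sums give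
  every eigenvalue total weight 1.\<close>

definition doubly_stochastic :: "nat \<Rightarrow> (nat \<Rightarrow> nat \<Rightarrow> real) \<Rightarrow> bool" where
  "doubly_stochastic n w \<longleftrightarrow> (\<forall>i<n. \<forall>j<n. 0 \<le> w i j) \<and>
     (\<forall>j<n. (\<Sum>i<n. w i j) = 1) \<and> (\<forall>i<n. (\<Sum>j<n. w i j) = 1)"

text \<open>The easy half of the Schur-Horn theorem. The change of basis \<open>Q\<close> from the
  eigenbasis \<open>U\<close> to \<open>V\<close> is unitary, and the squared moduli of its entries
  are the weights. Later \<open>V\<close> is an eigenbasis of a different matrix.\<close>

lemma unitary_conj_diag_doubly_stochastic:
  assumes U: "unitary_mat n U" and A: "A \<in> carrier_mat n n"
    and d: "mat_adjoint U * A * U = real_diag n d" and V: "unitary_mat n V"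
  shows "\<exists>w. doubly_stochastic n w \<and>
    (\<forall>j<n. (mat_adjoint V * A * V) $$ (j, j) = of_real (\<Sum>i<n. w i j * d i))"
proof -
  define Q where "Q = mat_adjoint U * V"
  have Q: "unitary_mat n Q"
    unfolding Q_def by (intro unitary_mat_mult unitary_mat_adjoint U V)
  note Uc = unitary_matD[OF U] and Vc = unitary_matD[OF V] and Qc = unitary_matD[OF Q]
  have "U * Q = V"
    using Uc Vc(1) by (simp add: Q_def flip: assoc_mult_mat[where n\<^sub>2=n and n\<^sub>3=n and n\<^sub>4=n and n\<^sub>1=n])
  hence "mat_adjoint V * A * V = mat_adjoint Q * real_diag n d * Q"
    using unitary_conj_mult[OF Uc(1) Qc(1) A] d by simp
  moreover have "doubly_stochastic n (\<lambda>i j. (cmod (Q $$ (i, j)))\<^sup>2)"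
    using unitary_mat_col_sum[OF Q] unitary_mat_row_sum[OF Q] by (simp add: doubly_stochastic_def)
  ultimately show ?thesis
    using real_diag_conj_diag[OF Qc(1)] by (intro exI[of _ "\<lambda>i j. (cmod (Q $$ (i, j)))\<^sup>2"]) auto
qed

text \<open>Each eigenvalue \<open>d i\<close> is the value of the quadratic form of
  \<open>A\<close> at column \<open>i\<close> of \<open>U\<close>.\<close>

lemma hermitian_psd_spectral:
  assumes A: "A \<in> carrier_mat n n" and psd: "hermitian_psd A"
  shows "\<exists>U d. unitary_mat n U \<and> mat_adjoint U * A * U = real_diag n d \<and> (\<forall>i<n. 0 \<le> d i)"
proof -
  obtain U d where U: "unitary_mat n U" and d: "mat_adjoint U * A * U = real_diag n d"
    using hermitian_spectral[OF A] psd by (auto simp: hermitian_psd_def)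
  note Uc = unitary_matD[OF U]
  have "0 \<le> d i" if i: "i < n" for i
  proof -
    have "of_real (d i) = real_diag n d $$ (i, i)"
      using i by (simp add: real_diag_def)
    also have "real_diag n d = mat_adjoint U * (A * U)"
      unfolding d[symmetric] using A Uc(1) by (intro assoc_mult_mat[of _ n n _ n _ n]) auto
    finally have "of_real (d i) = (mat_adjoint U * (A * U)) $$ (i, i)" .
    also have "\<dots> = row (mat_adjoint U) i \<bullet> col (A * U) i"
      using A Uc(1) i by (intro index_mult_mat) auto
    also have "col (A * U) i = A *\<^sub>v col U i"
      using A Uc(1) i by (intro col_mult2) auto
    also have "row (mat_adjoint U) i = conjugate (col U i)"
      using Uc(1) i by (intro eq_vecI) auto
    also have "conjugate (col U i) \<bullet> (A *\<^sub>v col U i) = (A *\<^sub>v col U i) \<bullet>c col U i"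
      using A Uc(1) i by (intro comm_scalar_prod[of _ n]) auto
    finally have "d i = Re ((A *\<^sub>v col U i) \<bullet>c col U i)"
      by (metis Re_complex_of_real)
    thus ?thesis
      using psd A Uc(1) i by (auto simp: hermitian_psd_def)
  qed
  thus ?thesis using U d by blast
qed

text \<open>For Hermitian \<open>A\<close> the matrix in the definition is the square of
  \<open>A\<close>, which is similar to the diagonal matrix of the \<open>d i * d i\<close>.
  Nonnegativity of the \<open>d i\<close> makes the square roots return them.\<close>

lemma singular_values_psd:
  assumes U: "unitary_mat n U" and A: "A \<in> carrier_mat n n" and hA: "hermitian_mat A"
    and d: "mat_adjoint U * A * U = real_diag n d" and nonneg: "\<forall>i<n. 0 \<le> d i"
  shows "singular_values A = rev (sort (map d [0..<n]))"
proof -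
  note Uc = unitary_matD[OF U]
  let ?D = "real_diag n (\<lambda>i. d i * d i)"
  have "mat_adjoint U * (A * A) * U = (mat_adjoint U * A * (U * mat_adjoint U)) * (A * U)"
    using A Uc by (simp add: mult_carrier_mat[where n=n] assoc_mult_mat[where n\<^sub>2=n and n\<^sub>3=n and n\<^sub>4=n and n\<^sub>1=n])
  also have "\<dots> = (mat_adjoint U * A * U) * (mat_adjoint U * A * U)"
    using A Uc(1) by (simp add: mult_carrier_mat[where n=n] assoc_mult_mat[where n\<^sub>2=n and n\<^sub>3=n and n\<^sub>4=n and n\<^sub>1=n])
  finally have D: "mat_adjoint U * (A * A) * U = ?D"
    by (simp add: d real_diag_mult)
  have "A * A = U * ?D * mat_adjoint U"
    using unitary_conj_cancel[OF U _ D] A by simp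
  hence "similar_mat_wit (A * A) ?D U (mat_adjoint U)"
    using A Uc by (intro similar_mat_witI[of _ _ n]) auto
  hence "char_poly (A * A) = char_poly ?D"
    by (intro char_poly_similar) (auto simp: similar_mat_def)
  also have "\<dots> = (\<Prod>a\<leftarrow>diag_mat ?D. [:- a, 1:])"
    by (rule char_poly_upper_triangular[of _ n]) (auto simp: real_diag_def)
  also have "diag_mat ?D = map (\<lambda>i. of_real (d i * d i)) [0..<n]"
    by (auto simp: diag_mat_def real_diag_def)
  finally have cp: "char_poly (A * A) = (\<Prod>a\<leftarrow>map (\<lambda>i. of_real (d i * d i)) [0..<n]. [:- a, 1:])" .
  have roots: "proots (\<Prod>a\<leftarrow>xs. [:- a, 1:]) = mset xs" for xs :: "complex list"
  proof (induction xs)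
    case (Cons a xs)
    have "(\<Prod>a\<leftarrow>xs. [:- a, 1:]) \<noteq> 0" by (auto simp: prod_list_zero_iff)
    thus ?case using Cons by (simp add: proots_mult del: mult_pCons_left)
  qed simp
  have "image_mset (\<lambda>z. sqrt (Re z)) (proots (char_poly (A * A)))
      = mset (map (\<lambda>i. sqrt (Re (of_real (d i * d i)))) [0..<n])"
    unfolding cp roots by (simp only: mset_map image_mset.compositionality o_def)
  also have "map (\<lambda>i. sqrt (Re (of_real (d i * d i)))) [0..<n] = map d [0..<n]"
    using nonneg by simp
  finally have "sorted_list_of_multiset (image_mset (\<lambda>z. sqrt (Re z)) (proots (char_poly (A * A))))
      = sort (map d [0..<n])"
    by (simp only: sorted_list_of_multiset_mset)
  \<comment> \<open>\<open>A\<close> is square, so the list has length \<open>n\<close> and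
    \<open>take\<close> cuts nothing off.\<close>
  thus ?thesis
    using A hA by (simp add: singular_values_def hermitian_mat_def)
qed

text \<open>Positivity of \<open>n\<close> excludes both the default value in
  \<open>two_norm\<close> and the maximum of an empty set.\<close>

lemma two_norm_eq_Max:
  assumes "singular_values A = rev (sort (map d [0..<n]))" "n > 0"
  shows "two_norm A = Max (d ` {..<n})"
proof -
  let ?s = "sort (map d [0..<n])"
  have ne: "?s \<noteq> []" using assms(2) by (metis length_0_conv length_map length_sort length_upt minus_nat.diff_0 less_numeral_extra(3))
  have "two_norm A = last ?s"
    using ne assms(1) by (simp add: two_norm_def hd_rev flip: hd_conv_nth)
  also have "\<dots> = Max (set ?s)"
  proof (rule Max_eqI[symmetric])
    fix y assume "y \<in> set ?s"
    then obtain i where i: "i < length ?s" "y = ?s ! i" by (metis in_set_conv_nth)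
    have "?s ! i \<le> ?s ! (length ?s - 1)"
      using i(1) by (intro sorted_nth_mono) auto
    thus "y \<le> last ?s"
      by (simp only: i(2) last_conv_nth[OF ne])
  qed (simp_all only: finite_set last_in_set[OF ne])
  also have "set ?s = d ` {..<n}" by (auto simp: lessThan_atLeast0)
  finally show ?thesis .
qed

lemma schatten_norm_eq_sum:
  assumes "singular_values A = rev (sort (map d [0..<n]))"
  shows "schatten_norm p A = (\<Sum>i<n. d i powr p) powr (1 / p)"
proof -
  \<comment> \<open>Passing to multisets discards the order in which the singular values are
    listed.\<close>
  have "(\<Sum>\<sigma>\<leftarrow>singular_values A. \<sigma> powr p) = sum_mset (mset (map (\<lambda>\<sigma>. \<sigma> powr p) (singular_values A)))"
    by (simp only: sum_mset_sum_list)
  also have "mset (map (\<lambda>\<sigma>. \<sigma> powr p) (singular_values A)) = mset (map (\<lambda>i. d i powr p) [0..<n])"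
    by (simp add: assms multiset.map_comp o_def)
  also have "sum_mset \<dots> = (\<Sum>i<n. d i powr p)"
    by (simp only: sum_mset_sum_list) (simp add: sum_list_distinct_conv_sum_set lessThan_atLeast0)
  finally show ?thesis by (simp add: schatten_norm_def)
qed

subsection \<open>Power sums\<close>

lemma convex_on_powr_nonneg:
  fixes p :: real
  assumes "1 \<le> p"
  shows "convex_on {0..} (\<lambda>x. x powr p)"
proof (rule convex_on_linorderI)
  fix t x y :: real
  assume t: "0 < t" "t < 1" and xy: "x \<in> {0..}" "y \<in> {0..}" "x < y"
  show "((1 - t) *\<^sub>R x + t *\<^sub>R y) powr p \<le> (1 - t) * x powr p + t * y powr p"
  \<comment> \<open>Because \<open>x < y\<close>, only \<open>x\<close> can be the boundary point 0.
    There the claim reduces to \<open>t powr p \<le> t\<close>, true for \<open>t\<close> below 1;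
    otherwise both points are positive.\<close>
  proof (cases "x = 0")
    case True
    have "t powr p \<le> t powr 1" using t assms by (intro powr_mono') auto
    hence "t powr p * y powr p \<le> t * y powr p" using t by (intro mult_right_mono) auto
    thus ?thesis using True t xy by (simp add: powr_mult)
  next
    case False
    thus ?thesis using convex_onD[OF powr_convex[OF assms], of t x y] t xy by auto
  qed
qed auto

text \<open>Jensen's inequality in each column \<open>j\<close>; after exchanging the sums, the row
  sums remove the weights.\<close>

lemma doubly_stochastic_powr_sum_le:
  fixes p :: real
  assumes p: "1 \<le> p" and w: "doubly_stochastic n w" and d: "\<forall>i<n. 0 \<le> d i"
  shows "(\<Sum>j<n. (\<Sum>i<n. w i j * d i) powr p) \<le> (\<Sum>i<n. d i powr p)"
proof -
  have "(\<Sum>j<n. (\<Sum>i<n. w i j * d i) powr p) \<le> (\<Sum>j<n. \<Sum>i<n. w i j * d i powr p)"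
  proof (rule sum_mono)
    fix j assume "j \<in> {..<n}"
    thus "(\<Sum>i<n. w i j * d i) powr p \<le> (\<Sum>i<n. w i j * d i powr p)"
      using convex_on_sum[OF _ _ convex_on_powr_nonneg[OF p], of "{..<n}" "\<lambda>i. w i j" d] w d
      by (auto simp: doubly_stochastic_def)
  qed
  also have "\<dots> = (\<Sum>i<n. (\<Sum>j<n. w i j) * d i powr p)"
    by (subst sum.swap) (simp add: sum_distrib_right)
  also have "\<dots> = (\<Sum>i<n. d i powr p)"
    using w by (auto simp: doubly_stochastic_def intro!: sum.cong)
  finally show ?thesis .
qed

text \<open>Scale \<open>f\<close> and \<open>g\<close> to norm 1. Then
  \<open>(f i + g i) / (a + b)\<close> is a convex combination of \<open>f i / a\<close> and
  \<open>g i / b\<close> with weights independent of \<open>i\<close>, so convexity bounds its power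
  sum by 1.\<close>

lemma Minkowski_powr_sum:
  fixes p :: real and f g :: "'a \<Rightarrow> real"
  assumes p: "1 \<le> p" and fin: "finite S"
    and f: "\<And>i. i \<in> S \<Longrightarrow> 0 \<le> f i" and g: "\<And>i. i \<in> S \<Longrightarrow> 0 \<le> g i"
  shows "(\<Sum>i\<in>S. (f i + g i) powr p) powr (1 / p)
    \<le> (\<Sum>i\<in>S. f i powr p) powr (1 / p) + (\<Sum>i\<in>S. g i powr p) powr (1 / p)"
    (is "_ \<le> ?a + ?b")
proof -
  \<comment> \<open>If one norm vanishes, so does the function itself on \<open>S\<close>; scaling
    is then impossible, but the claim is trivial.\<close>
  have zero: "\<forall>i\<in>S. h i = 0" if "(\<Sum>i\<in>S. h i powr p) powr (1 / p) = 0" for h :: "'a \<Rightarrow> real"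
    using that fin by (simp add: sum_nonneg_eq_0_iff)
  consider "?a = 0" | "?b = 0" | "0 < ?a" "0 < ?b"
    by (metis less_eq_real_def powr_ge_zero)
  thus ?thesis
  proof cases
    case 1
    thus ?thesis using zero[OF 1] by simp
  next
    case 2
    thus ?thesis using zero[OF 2] by simp
  next
    case 3
    define a b where "a = ?a" and "b = ?b"
    hence ab: "0 < a" "0 < b" using 3 by simp_all
    let ?t = "b / (a + b)"
    have "0 \<le> y / (x + y)" "y / (x + y) \<le> 1" "1 - y / (x + y) = x / (x + y)"
      if "0 < x" "0 < y" for x y :: real
      using that by (auto simp: field_simps)
    note t = this[OF ab]
    have ap: "(\<Sum>i\<in>S. f i powr p) = a powr p" and bp: "(\<Sum>i\<in>S. g i powr p) = b powr p"
      using p by (simp_all add: a_def b_def powr_powr sum_nonneg)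
    have "((f i + g i) / (a + b)) powr p \<le> (1 - ?t) * (f i / a) powr p + ?t * (g i / b) powr p"
      if "i \<in> S" for i
    proof -
      have "(f i + g i) / (a + b) = (1 - ?t) *\<^sub>R (f i / a) + ?t *\<^sub>R (g i / b)"
        unfolding t(3) using ab by (simp add: add_divide_distrib)
      moreover have "f i / a \<in> {0..}" "g i / b \<in> {0..}"
        using f g ab that by simp_all
      moreover note convex_onD[OF convex_on_powr_nonneg[OF p] t(1,2) this]
      ultimately show ?thesis by (simp only:)
    qed
    hence "(\<Sum>i\<in>S. ((f i + g i) / (a + b)) powr p)
        \<le> (\<Sum>i\<in>S. (1 - ?t) * (f i / a) powr p + ?t * (g i / b) powr p)"
      by (rule sum_mono)
    also have "\<dots> = (1 - ?t) * (\<Sum>i\<in>S. (f i / a) powr p) + ?t * (\<Sum>i\<in>S. (g i / b) powr p)"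
      by (simp only: sum.distrib sum_distrib_left)
    also have "(\<Sum>i\<in>S. (f i / a) powr p) = (\<Sum>i\<in>S. f i powr p) / a powr p"
      using f by (simp add: powr_divide sum_divide_distrib)
    also have "\<dots> = 1"
      using ab(1) by (simp add: ap)
    also have "(\<Sum>i\<in>S. (g i / b) powr p) = (\<Sum>i\<in>S. g i powr p) / b powr p"
      using g by (simp add: powr_divide sum_divide_distrib)
    also have "\<dots> = 1"
      using ab(2) by (simp add: bp)
    finally have "(\<Sum>i\<in>S. ((f i + g i) / (a + b)) powr p) \<le> 1" by simp
    moreover have "(\<Sum>i\<in>S. ((f i + g i) / (a + b)) powr p)
        = (\<Sum>i\<in>S. (f i + g i) powr p) / (a + b) powr p"
      using f g by (simp add: powr_divide sum_divide_distrib)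
    ultimately have "(\<Sum>i\<in>S. (f i + g i) powr p) \<le> (a + b) powr p"
      using ab by (simp add: divide_le_eq)
    hence "(\<Sum>i\<in>S. (f i + g i) powr p) powr (1 / p) \<le> ((a + b) powr p) powr (1 / p)"
      using p by (intro powr_mono2) (auto intro: sum_nonneg)
    also have "\<dots> = a + b"
      using p ab by (simp add: powr_powr)
    finally show ?thesis unfolding a_def b_def .
  qed
qed

subsection \<open>Rank one and stable rank\<close>

text \<open>A maximal independent set of columns consists of one vector \<open>u\<close>, and every
  column is a multiple of it: \<open>f\<close> lists the entries of \<open>u\<close> and
  \<open>g\<close> the multipliers.\<close>

lemma rank_1_product_entries:
  fixes A :: "complex mat"
  assumes A: "A \<in> carrier_mat n nc" and r: "vec_space.rank n A = 1"
  shows "\<exists>f g. \<forall>i<n. \<forall>j<nc. A $$ (i, j) = f i * g j"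
proof -
  interpret vec_space "TYPE(complex)" n .
  have cols: "set (cols A) \<subseteq> carrier_vec n" using A cols_dim by blast
  obtain S where S: "maximal S (\<lambda>T. T \<subseteq> set (cols A) \<and> lin_indpt T)"
    using maximal_exists[of "\<lambda>T. T \<subseteq> set (cols A) \<and> lin_indpt T" "card (set (cols A))" "{}"]
    by (meson List.finite_set card_mono empty_iff empty_subsetI finite_lin_indpt2 rev_finite_subset)
  hence "card S = 1" using rank_card_indpt[OF A S] r by simp
  then obtain u where u: "S = {u}" using card_1_singletonE by blast
  hence uc: "u \<in> carrier_vec n" and ind: "lin_indpt {u}" using S cols by (auto simp: maximal_def)
  have "\<exists>g. col A j = g \<cdot>\<^sub>v u" if "j < nc" for j
  proof -
    have cj: "col A j \<in> set (cols A)" using A that by (auto simp: cols_def)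
    hence c: "col A j \<in> carrier_vec n" using cols by blast
    have "col A j \<in> span {u}"
    proof (rule ccontr)
      assume *: "col A j \<notin> span {u}"
      \<comment> \<open>\<open>u\<close> lies in its own span, so a column outside the span is a new
        vector, and adjoining it would contradict maximality of \<open>{u}\<close>.\<close>
      hence nu: "col A j \<noteq> u" using uc in_own_span[of "{u}"] by auto
      have "lin_indpt (insert (col A j) {u})"
        using lin_dep_iff_in_span[of "{u}" "col A j"] * uc c ind nu by auto
      hence "insert (col A j) {u} = {u}"
        using S cj unfolding u maximal_def by blast
      thus False using nu by blast
    qed
    then obtain a where "lincomb a {u} = col A j"
      using finite_in_span[of "{u}"] uc by auto
    hence "col A j = a u \<cdot>\<^sub>v u" using uc by (simp add: lincomb_def)
    thus ?thesis by blast
  qed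
  then obtain g where g: "\<And>j. j < nc \<Longrightarrow> col A j = g j \<cdot>\<^sub>v u" by metis
  have "A $$ (i, j) = u $ i * g j" if "i < n" "j < nc" for i j
  proof -
    have "A $$ (i, j) = col A j $ i" using A that by simp
    thus ?thesis using g[OF that(2)] uc that by simp
  qed
  thus ?thesis by blast
qed

text \<open>\<open>B\<close> is a column times a row and remains so after conjugation by
  \<open>U\<close>. A diagonal matrix of this form has at most one nonzero entry; with none,
  \<open>B\<close> would be zero and have rank 0.\<close>

lemma rank_1_psd_spectral:
  assumes U: "unitary_mat n U" and B: "B \<in> carrier_mat n n" and r: "vec_space.rank n B = 1"
    and d: "mat_adjoint U * B * U = real_diag n d"
  shows "\<exists>k<n. d k \<noteq> 0 \<and> (\<forall>i<n. i \<noteq> k \<longrightarrow> d i = 0)"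
proof -
  note Uc = unitary_matD[OF U]
  obtain f g where fg: "\<And>i j. i < n \<Longrightarrow> j < n \<Longrightarrow> B $$ (i, j) = f i * g j"
    using rank_1_product_entries[OF B r] by blast
  define X where "X = mat n 1 (\<lambda>(i, _). f i)"
  define Y where "Y = mat 1 n (\<lambda>(_, j). g j)"
  have X: "X \<in> carrier_mat n 1" and Y: "Y \<in> carrier_mat 1 n" by (simp_all add: X_def Y_def)
  have "B = X * Y"
    using B fg by (intro eq_matI) (auto simp: X_def Y_def scalar_prod_def)
  hence D: "real_diag n d = (mat_adjoint U * X) * (Y * U)"
    using d X Y Uc(1)
    by (simp add: assoc_mult_mat[where n\<^sub>1=n and n\<^sub>2=n and n\<^sub>3=1 and n\<^sub>4=n]
        assoc_mult_mat[where n\<^sub>1=n and n\<^sub>2=n and n\<^sub>3=n and n\<^sub>4=n]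
        assoc_mult_mat[where n\<^sub>1=n and n\<^sub>2=1 and n\<^sub>3=n and n\<^sub>4=n] mult_carrier_mat[where n=1] mult_carrier_mat[where n=n])
  let ?x = "\<lambda>i. (mat_adjoint U * X) $$ (i, 0)" and ?y = "\<lambda>j. (Y * U) $$ (0, j)"
  have Dij: "(if i = j then of_real (d i) else 0) = ?x i * ?y j" if "i < n" "j < n" for i j
  proof -
    have "(if i = j then of_real (d i) else 0) = real_diag n d $$ (i, j)"
      using that by (simp add: real_diag_def)
    also have "\<dots> = row (mat_adjoint U * X) i \<bullet> col (Y * U) j"
      unfolding D using X Y Uc(1) that by (intro index_mult_mat) auto
    also have "\<dots> = ?x i * ?y j"
      using X Y Uc(1) that by (simp add: scalar_prod_def)
    finally show ?thesis .
  qed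
  \<comment> \<open>the diagonalized matrix still has rank one, so its 2 by 2 minors vanish\<close>
  have one: "d i = 0 \<or> d j = 0" if "i < n" "j < n" "i \<noteq> j" for i j
  proof -
    have "complex_of_real (d i) * of_real (d j) = (?x i * ?y j) * (?x j * ?y i)"
      using Dij[of i i] Dij[of j j] that by simp
    also have "\<dots> = 0" using Dij[of i j] that by auto
    finally show ?thesis by simp
  qed
  have "\<exists>k<n. d k \<noteq> 0"
  proof (rule ccontr)
    assume "\<not> ?thesis"
    hence "real_diag n d = 0\<^sub>m n n" by (intro eq_matI) (auto simp: real_diag_def)
    hence "B = 0\<^sub>m n n"
      using unitary_conj_cancel[OF U B d] Uc(1) by simp
    thus False using r vec_space.rank_0I[of n n, where 'a=complex] by simp
  qed
  thus ?thesis using one by metis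
qed

text \<open>Multiplying out the largest eigenvalue covers the zero matrix too: its stable rank is 0
  by convention and all \<open>d i\<close> vanish, so both sides are 0.\<close>

lemma stable_rank_powr_inverse:
  assumes U: "unitary_mat n U" and A: "A \<in> carrier_mat n n" and psd: "hermitian_psd A" and n: "n > 0"
    and d: "mat_adjoint U * A * U = real_diag n d" "\<forall>i<n. 0 \<le> d i" and p: "1 \<le> p"
  shows "stable_rank p A powr (1 / p) * Max (d ` {..<n}) = (\<Sum>i<n. d i powr p) powr (1 / p)"
proof -
  have sv: "singular_values A = rev (sort (map d [0..<n]))"
    using singular_values_psd[OF U A _ d] psd by (simp add: hermitian_psd_def)
  have le: "d i \<le> Max (d ` {..<n})" if "i < n" for i using that by simp
  show ?thesis
  proof (cases "A = 0\<^sub>m n n")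
    case True
    have "real_diag n d = 0\<^sub>m n n"
      using d(1) unitary_matD(1)[OF U] by (simp add: True)
    hence "of_real (d i) = (0 :: complex)" if "i < n" for i
    proof -
      have "real_diag n d $$ (i, i) = 0" using that \<open>real_diag n d = 0\<^sub>m n n\<close> by simp
      thus ?thesis using that by (simp add: real_diag_def)
    qed
    thus ?thesis using A True by (simp add: stable_rank_def)
  next
    case False
    have "\<exists>i<n. d i \<noteq> 0"
    proof (rule ccontr)
      assume "\<not> ?thesis"
      hence "real_diag n d = 0\<^sub>m n n" by (intro eq_matI) (auto simp: real_diag_def)
      thus False
        using False unitary_conj_cancel[OF U A d(1)] unitary_matD(1)[OF U] by simp
    qed
    then obtain i where i: "i < n" "d i > 0" using d(2) by (metis order_le_less)
    hence M: "Max (d ` {..<n}) > 0" using le[OF i(1)] by linarith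
    have "stable_rank p A powr (1 / p)
        = schatten_norm p A / two_norm A"
      using A False p M by (simp add: stable_rank_def two_norm_eq_Max[OF sv n] schatten_norm_eq_sum[OF sv]
          powr_divide powr_powr sum_nonneg)
    thus ?thesis
      using M by (simp add: two_norm_eq_Max[OF sv n] schatten_norm_eq_sum[OF sv])
  qed
qed

section \<open>Eigenvalues of sums of positive semi-definite matrices\<close>

lemma unitary_conj_diag_add:
  assumes "V \<in> carrier_mat n n" "A \<in> carrier_mat n n" "B \<in> carrier_mat n n" "j < n"
  shows "(mat_adjoint V * (A + B) * V) $$ (j, j)
    = (mat_adjoint V * A * V) $$ (j, j) + (mat_adjoint V * B * V) $$ (j, j)"
proof -
  have "mat_adjoint V * (A + B) * V = mat_adjoint V * A * V + mat_adjoint V * B * V"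
    using assms by (simp add: mult_add_distrib_mat[of _ n n _ n] add_mult_distrib_mat[of _ n n _ _ n]
        mult_carrier_mat[where n=n])
  thus ?thesis using assms by simp
qed

lemma hermitian_psd_add:
  assumes A: "A \<in> carrier_mat n n" and B: "B \<in> carrier_mat n n"
    and "hermitian_psd A" "hermitian_psd B"
  shows "hermitian_psd (A + B)"
proof -
  have "mat_adjoint (A + B) = mat_adjoint A + mat_adjoint B"
    using A B by (intro eq_matI) auto
  hence "mat_adjoint (A + B) = A + B"
    using assms(3,4) by (simp add: hermitian_psd_def hermitian_mat_def)
  moreover have "0 \<le> Re (((A + B) *\<^sub>v v) \<bullet>c v)" if v: "v \<in> carrier_vec n" for v
  proof -
    have "((A + B) *\<^sub>v v) \<bullet>c v = (A *\<^sub>v v) \<bullet>c v + (B *\<^sub>v v) \<bullet>c v"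
      using A B v by (simp add: add_mult_distrib_mat_vec[of _ n n] add_scalar_prod_distrib[of _ n])
    moreover have "0 \<le> Re ((A *\<^sub>v v) \<bullet>c v)" "0 \<le> Re ((B *\<^sub>v v) \<bullet>c v)"
      using assms(3,4) A B v by (auto simp: hermitian_psd_def)
    ultimately show ?thesis by simp
  qed
  ultimately show ?thesis
    using A B by (auto simp: hermitian_psd_def hermitian_mat_def)
qed

text \<open>Evaluate the quadratic forms at the eigenvector in column \<open>i\<close> of
  \<open>U\<close>. There \<open>A + B\<close> takes the value \<open>a i\<close> plus a nonnegative
  contribution of \<open>B\<close>, and this value is an average of the \<open>c k\<close>.\<close>

lemma psd_eigenvalue_le_Max_add:
  assumes U: "unitary_mat n U" "mat_adjoint U * A * U = real_diag n a"
    and W: "unitary_mat n W" "mat_adjoint W * (A + B) * W = real_diag n c"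
    and A: "A \<in> carrier_mat n n" and B: "B \<in> carrier_mat n n" and psd: "hermitian_psd B"
    and i: "i < n"
  shows "a i \<le> Max (c ` {..<n})"
proof -
  obtain V b where V: "unitary_mat n V" "mat_adjoint V * B * V = real_diag n b" "\<forall>i<n. 0 \<le> b i"
    using hermitian_psd_spectral[OF B psd] by blast
  obtain v where v: "doubly_stochastic n v"
      "\<forall>j<n. (mat_adjoint U * B * U) $$ (j, j) = of_real (\<Sum>i<n. v i j * b i)"
    using unitary_conj_diag_doubly_stochastic[OF V(1) B V(2) U(1)] by blast
  obtain w where w: "doubly_stochastic n w"
      "\<forall>j<n. (mat_adjoint U * (A + B) * U) $$ (j, j) = of_real (\<Sum>i<n. w i j * c i)"
    using unitary_conj_diag_doubly_stochastic[OF W(1) _ W(2) U(1)] A B by auto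
  have "complex_of_real (\<Sum>k<n. w k i * c k) = of_real (a i) + of_real (\<Sum>k<n. v k i * b k)"
    using unitary_conj_diag_add[OF unitary_matD(1)[OF U(1)] A B i] v(2) w(2) U(2) i
    by (simp add: real_diag_def)
  hence "(\<Sum>k<n. w k i * c k) = a i + (\<Sum>k<n. v k i * b k)"
    by (simp only: of_real_add[symmetric] of_real_eq_iff)
  moreover have "0 \<le> (\<Sum>k<n. v k i * b k)"
    using v(1) V(3) i by (intro sum_nonneg) (auto simp: doubly_stochastic_def)
  moreover have "(\<Sum>k<n. w k i * c k) \<le> (\<Sum>k<n. w k i * Max (c ` {..<n}))"
    using w(1) i by (intro sum_mono mult_left_mono) (auto simp: doubly_stochastic_def)
  moreover have "\<dots> = Max (c ` {..<n})"
    using w(1) i by (simp add: doubly_stochastic_def flip: sum_distrib_right)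
  ultimately show ?thesis by simp
qed

lemma psd_powr_sum_triangle:
  fixes p :: real
  assumes p: "1 \<le> p" and A: "A \<in> carrier_mat n n" and B: "B \<in> carrier_mat n n"
    and U: "unitary_mat n U" "mat_adjoint U * A * U = real_diag n a" "\<forall>i<n. 0 \<le> a i"
    and V: "unitary_mat n V" "mat_adjoint V * B * V = real_diag n b" "\<forall>i<n. 0 \<le> b i"
    and W: "unitary_mat n W" "mat_adjoint W * (A + B) * W = real_diag n c"
  shows "(\<Sum>i<n. c i powr p) powr (1 / p)
    \<le> (\<Sum>i<n. a i powr p) powr (1 / p) + (\<Sum>i<n. b i powr p) powr (1 / p)"
proof -
  obtain u where u: "doubly_stochastic n u"
      "\<forall>j<n. (mat_adjoint W * A * W) $$ (j, j) = of_real (\<Sum>i<n. u i j * a i)"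
    using unitary_conj_diag_doubly_stochastic[OF U(1) A U(2) W(1)] by blast
  obtain v where v: "doubly_stochastic n v"
      "\<forall>j<n. (mat_adjoint W * B * W) $$ (j, j) = of_real (\<Sum>i<n. v i j * b i)"
    using unitary_conj_diag_doubly_stochastic[OF V(1) B V(2) W(1)] by blast
  \<comment> \<open>The diagonals of \<open>A\<close> and \<open>B\<close> in the eigenbasis
    \<open>W\<close> of \<open>A + B\<close>; they add up exactly to the eigenvalues
    \<open>c j\<close>.\<close>
  let ?f = "\<lambda>j. \<Sum>i<n. u i j * a i" and ?g = "\<lambda>j. \<Sum>i<n. v i j * b i"
  have c: "c j = ?f j + ?g j" if "j < n" for j
  proof -
    have "complex_of_real (c j) = of_real (?f j) + of_real (?g j)"
      using unitary_conj_diag_add[OF unitary_matD(1)[OF W(1)] A B that] u(2) v(2) W(2) that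
      by (simp add: real_diag_def)
    thus ?thesis by (simp only: of_real_add[symmetric] of_real_eq_iff)
  qed
  have f: "0 \<le> ?f j" if "j \<in> {..<n}" for j
    using u(1) U(3) that by (intro sum_nonneg) (auto simp: doubly_stochastic_def)
  have g: "0 \<le> ?g j" if "j \<in> {..<n}" for j
    using v(1) V(3) that by (intro sum_nonneg) (auto simp: doubly_stochastic_def)
  have "(\<Sum>j<n. c j powr p) powr (1 / p) = (\<Sum>j<n. (?f j + ?g j) powr p) powr (1 / p)"
    by (simp add: c)
  also have "\<dots> \<le> (\<Sum>j<n. ?f j powr p) powr (1 / p) + (\<Sum>j<n. ?g j powr p) powr (1 / p)"
    by (rule Minkowski_powr_sum[OF p _ f g]) auto
  \<comment> \<open>Each diagonal has at most the power sum of the spectrum of its matrix.\<close>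
  also have "\<dots> \<le> (\<Sum>i<n. a i powr p) powr (1 / p) + (\<Sum>i<n. b i powr p) powr (1 / p)"
    using p doubly_stochastic_powr_sum_le[OF p u(1) U(3)] doubly_stochastic_powr_sum_le[OF p v(1) V(3)]
    by (intro add_mono powr_mono2) (auto intro: sum_nonneg)
  finally show ?thesis .
qed

theorem theorem5p12:
  fixes p :: real and n :: nat and A B :: "complex mat"
  assumes "1 \<le> p"
    and "A \<in> carrier_mat n n" and "B \<in> carrier_mat n n"
    and "hermitian_psd A" and "hermitian_psd B"
    and "vec_space.rank n B = 1"
  shows "1 \<le> stable_rank p (A + B) powr (1 / p) \<and>
         stable_rank p (A + B) powr (1 / p) \<le> 1 + stable_rank p A powr (1 / p)"
proof -
  note p = assms(1) and A = assms(2) and B = assms(3) and psdA = assms(4) and psdB = assms(5)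
  have AB: "A + B \<in> carrier_mat n n" using A B by simp
  have psdAB: "hermitian_psd (A + B)" by (rule hermitian_psd_add[OF A B psdA psdB])
  obtain U a where U: "unitary_mat n U" "mat_adjoint U * A * U = real_diag n a" "\<forall>i<n. 0 \<le> a i"
    using hermitian_psd_spectral[OF A psdA] by blast
  obtain V b where V: "unitary_mat n V" "mat_adjoint V * B * V = real_diag n b" "\<forall>i<n. 0 \<le> b i"
    using hermitian_psd_spectral[OF B psdB] by blast
  obtain W c where W: "unitary_mat n W" "mat_adjoint W * (A + B) * W = real_diag n c" "\<forall>i<n. 0 \<le> c i"
    using hermitian_psd_spectral[OF AB psdAB] by blast
  obtain k where k: "k < n" "b k \<noteq> 0" "\<forall>i<n. i \<noteq> k \<longrightarrow> b i = 0"
    using rank_1_psd_spectral[OF V(1) B assms(6) V(2)] by blast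
  have n: "n > 0" using k(1) by simp
  let ?M = "Max (a ` {..<n})" and ?N = "Max (c ` {..<n})"
  let ?x = "stable_rank p A powr (1 / p)" and ?y = "stable_rank p (A + B) powr (1 / p)"
  let ?L = "(\<Sum>i<n. c i powr p) powr (1 / p)"
  \<comment> \<open>Both bounds are proved after multiplication by \<open>?N\<close>, the two-norm
    of \<open>A + B\<close>, which is cancelled at the end.\<close>
  have x: "?x * ?M = (\<Sum>i<n. a i powr p) powr (1 / p)"
    by (rule stable_rank_powr_inverse[OF U(1) A psdA n U(2,3) p])
  have y: "?y * ?N = ?L"
    by (rule stable_rank_powr_inverse[OF W(1) AB psdAB n W(2,3) p])
  have MN: "?M \<le> ?N"
    using psd_eigenvalue_le_Max_add[OF U(1,2) W(1,2) A B psdB] n by (intro Max.boundedI) auto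
  \<comment> \<open>The same comparison with the roles of \<open>A\<close> and \<open>B\<close>
    exchanged. As \<open>b k\<close> is positive, so is \<open>?N\<close>.\<close>
  have bN: "b k \<le> ?N"
    using psd_eigenvalue_le_Max_add[OF V(1,2) W(1) _ B A psdA k(1)] W(2) comm_add_mat[OF A B] by simp
  have "0 < b k" using V(3) k by (metis order_le_less)
  hence N: "0 < ?N" using bN by simp
  \<comment> \<open>Only index \<open>k\<close> contributes, since \<open>0 powr p = 0\<close>;
    hence the Schatten norm of \<open>B\<close> is its only nonzero eigenvalue.\<close>
  have "(\<Sum>i<n. b i powr p) = (\<Sum>i\<in>{k}. b i powr p)"
    using k by (intro sum.mono_neutral_right) auto
  hence bk: "(\<Sum>i<n. b i powr p) powr (1 / p) = b k"
    using p \<open>0 < b k\<close> by (simp add: powr_powr)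
  have "?L \<le> ?x * ?M + b k"
    using psd_powr_sum_triangle[OF p A B U V W(1,2)] x bk by simp
  also have "\<dots> \<le> ?x * ?N + ?N"
    using MN bN by (intro add_mono mult_left_mono) auto
  finally have upper: "?y * ?N \<le> (1 + ?x) * ?N"
    unfolding y by (simp add: algebra_simps)
  \<comment> \<open>Lower bound: the largest eigenvalue contributes one term to the power sum, whose
    other terms are nonnegative.\<close>
  have "?N \<in> c ` {..<n}" using n by (intro Max_in) auto
  then obtain m where m: "m < n" "?N = c m" by auto
  have "c m powr p \<le> (\<Sum>i<n. c i powr p)"
    using m(1) by (intro member_le_sum) auto
  hence "(c m powr p) powr (1 / p) \<le> ?L"
    using p by (intro powr_mono2) auto
  hence "1 * ?N \<le> ?y * ?N"
    using p N unfolding y unfolding m(2) by (simp add: powr_powr)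
  thus ?thesis
    using upper N by (simp only: mult_le_cancel_right_pos)
qed

end
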